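(* Let $X$ be a nonempty set, let $\mathcal{C}\subseteq\mathcal{P}(X)$ be a nonempty set of subsets of $X$, and let $\Delta:\mathcal{C}\to\mathcal{P}(X)$ be a mapping such that $C\subseteq\Delta(C)$ for every $C\in\mathcal{C}$. Consider the following two conditions. (V1) There exist a bounded set function $\gamma:\mathcal{C}\to[0,\infty)$ and a finite constant $\lambda>1$ such that if $C_1,C_2\in\mathcal{C}$, $C_1\cap C_2\neq\emptyset$ and $\gamma(C_1)\leq\lambda\gamma(C_2)$, then $C_1\subseteq\Delta(C_2)$. (V2) There exists a bounded set function $\gamma:\mathcal{C}\to[0,\infty)$ such that for every nonempty subfamily $\mathcal{G}$ of $\mathcal{C}$ the maximum of $\{\gamma(C):C\in\mathcal{G}\}$ exists, and such that if $C_1,C_2\in\mathcal{C}$, $C_1\cap C_2\neq\emptyset$ and $\gamma(C_1)\leq\gamma(C_2)$, then $C_1\subseteq\Delta(C_2)$. Suppose that either (V1) or (V2) is satisfied. Then there exists a subfamily $\mathcal{D}\subseteq\mathcal{C}$ such that the members of $\mathcal{D}$ are pairwise disjoint and $$\bigcup_{C\in\mathcal{C}}C\subseteq\bigcup_{D\in\mathcal{D}}\Delta(D).$$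
   Context: $\mathcal{P}(X)$ denotes the power set of $X$. *)

theory Defs
  imports "HOL-Analysis.Analysis"
begin

(* Maps defined on \<C> are rendered as total functions constrained only on \<C>.
   The constant \<lambda> of the text is called \<kappa>, since \<lambda> is the abstraction symbol. *)

definition has_maximum :: "real set \<Rightarrow> bool" where
  "has_maximum S \<longleftrightarrow> (\<exists>m\<in>S. \<forall>s\<in>S. s \<le> m)"

definition V1 :: "'a set set \<Rightarrow> ('a set \<Rightarrow> 'a set) \<Rightarrow> bool" where
  "V1 \<C> \<Delta> \<longleftrightarrow>
    (\<exists>(\<gamma> :: 'a set \<Rightarrow> real) (\<kappa> :: real).
       \<gamma> \<in> \<C> \<rightarrow> {0..} \<and> bounded (\<gamma> ` \<C>) \<and> \<kappa> > 1 \<and>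
       (\<forall>C\<^sub>1\<in>\<C>. \<forall>C\<^sub>2\<in>\<C>. C\<^sub>1 \<inter> C\<^sub>2 \<noteq> {} \<and> \<gamma> C\<^sub>1 \<le> \<kappa> * \<gamma> C\<^sub>2 \<longrightarrow> C\<^sub>1 \<subseteq> \<Delta> C\<^sub>2))"

definition V2 :: "'a set set \<Rightarrow> ('a set \<Rightarrow> 'a set) \<Rightarrow> bool" where
  "V2 \<C> \<Delta> \<longleftrightarrow>
    (\<exists>\<gamma> :: 'a set \<Rightarrow> real.
       \<gamma> \<in> \<C> \<rightarrow> {0..} \<and> bounded (\<gamma> ` \<C>) \<and>
       (\<forall>\<G>. \<G> \<subseteq> \<C> \<and> \<G> \<noteq> {} \<longrightarrow> has_maximum (\<gamma> ` \<G>)) \<and>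
       (\<forall>C\<^sub>1\<in>\<C>. \<forall>C\<^sub>2\<in>\<C>. C\<^sub>1 \<inter> C\<^sub>2 \<noteq> {} \<and> \<gamma> C\<^sub>1 \<le> \<gamma> C\<^sub>2 \<longrightarrow> C\<^sub>1 \<subseteq> \<Delta> C\<^sub>2))"

end

theory Submission imports Defs begin

text \<open>
  Zorn's lemma is applied to the disjoint subfamilies \<open>\<D>\<close> such that every member of \<open>\<C>\<close> meeting
  \<open>\<Union>\<D>\<close> is already contained in \<open>\<Delta> D\<close> for some \<open>D \<in> \<D>\<close>. If a maximal such family left some
  nonempty members of \<open>\<C>\<close> unmet, one could add an unmet member that is maximal for \<open>\<gamma>\<close>
  up to the factor allowed by the hypothesis.
\<close>

text \<open>The function \<gamma> is abstracted away here: \<open>dominant\<close> is what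
  \<open>V1\<close> and \<open>V2\<close> have in common, so one maximality argument serves
  both.\<close>

lemma exists_disjoint_cover:
  assumes dominant: "\<And>\<G>. \<lbrakk>\<G> \<subseteq> \<C>; \<G> \<noteq> {}\<rbrakk> \<Longrightarrow> \<exists>M\<in>\<G>. \<forall>C\<in>\<G>. C \<inter> M \<noteq> {} \<longrightarrow> C \<subseteq> \<Delta> M"
  shows "\<exists>\<D>\<subseteq>\<C>. pairwise disjnt \<D> \<and> \<Union>\<C> \<subseteq> (\<Union>D\<in>\<D>. \<Delta> D)"
proof -
  define \<A> where "\<A> = {\<D>. \<D> \<subseteq> \<C> \<and> pairwise disjnt \<D> \<and>
    (\<forall>C\<in>\<C>. C \<inter> \<Union>\<D> \<noteq> {} \<longrightarrow> (\<exists>D\<in>\<D>. C \<subseteq> \<Delta> D))}"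
  have "\<exists>\<D>\<in>\<A>. \<forall>\<E>\<in>\<A>. \<D> \<subseteq> \<E> \<longrightarrow> \<E> = \<D>"
  proof (rule subset_Zorn')
    fix \<K> assume chain: "subset.chain \<A> \<K>"
    then have sub: "\<K> \<subseteq> \<A>" by (simp add: subset.chain_def)
    have "pairwise disjnt (\<Union>\<K>)"
      using chain sub unfolding \<A>_def
      by (intro pairwise_chain_Union) (auto simp: subset.chain_def chains_def chain_subset_def)
    moreover have "\<Union>\<K> \<subseteq> \<C>"
      using sub unfolding \<A>_def by blast
    \<comment> \<open>Meeting the union of the chain means meeting the union of a single family in
      it, whose own covering property applies. For the empty chain this is vacuous.\<close>
    moreover have "\<exists>D\<in>\<Union>\<K>. C \<subseteq> \<Delta> D" if "C \<in> \<C>" "C \<inter> \<Union>(\<Union>\<K>) \<noteq> {}" for C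
    proof -
      from that(2) obtain \<D> where \<D>: "\<D> \<in> \<K>" "C \<inter> \<Union>\<D> \<noteq> {}" by blast
      with sub that(1) have "\<exists>D\<in>\<D>. C \<subseteq> \<Delta> D" unfolding \<A>_def by blast
      with \<D>(1) show ?thesis by blast
    qed
    ultimately show "\<Union>\<K> \<in> \<A>" unfolding \<A>_def by blast
  qed
  then obtain \<D> where "\<D> \<in> \<A>" and maximal: "\<And>\<E>. \<lbrakk>\<E> \<in> \<A>; \<D> \<subseteq> \<E>\<rbrakk> \<Longrightarrow> \<E> = \<D>" by blast
  then have \<D>: "\<D> \<subseteq> \<C>" "pairwise disjnt \<D>"
    and covered: "\<And>C. \<lbrakk>C \<in> \<C>; C \<inter> \<Union>\<D> \<noteq> {}\<rbrakk> \<Longrightarrow> \<exists>D\<in>\<D>. C \<subseteq> \<Delta> D"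
    unfolding \<A>_def by auto
  \<comment> \<open>The empty set would always count as unmet, so it is excluded. This makes any
    \<open>M\<close> in \<G> differ from all members of \<D>, and the empty set needs no
    covering.\<close>
  define \<G> where "\<G> = {C \<in> \<C>. C \<noteq> {} \<and> C \<inter> \<Union>\<D> = {}}"
  have "\<G> = {}"
  proof (rule ccontr)
    assume "\<G> \<noteq> {}"
    moreover have "\<G> \<subseteq> \<C>" unfolding \<G>_def by blast
    ultimately obtain M where M: "M \<in> \<G>"
      and dom: "\<And>C. \<lbrakk>C \<in> \<G>; C \<inter> M \<noteq> {}\<rbrakk> \<Longrightarrow> C \<subseteq> \<Delta> M"
      using dominant[of \<G>] by auto
    have "insert M \<D> \<subseteq> \<C>"
      using M \<D>(1) unfolding \<G>_def by blast
    moreover have "pairwise disjnt (insert M \<D>)"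
      using M \<D>(2) unfolding \<G>_def by (auto simp: pairwise_insert disjnt_def)
    moreover have "\<exists>D\<in>insert M \<D>. C \<subseteq> \<Delta> D" if "C \<in> \<C>" "C \<inter> \<Union>(insert M \<D>) \<noteq> {}" for C
    \<comment> \<open>A set that misses \<Union>\<D> must meet \<open>M\<close>, hence is nonempty
      and lies in \<G>, where \<open>M\<close> dominates. Any other set was already covered by
      \<D>.\<close>
    proof (cases "C \<inter> \<Union>\<D> = {}")
      case True
      with that have "C \<in> \<G>" "C \<inter> M \<noteq> {}" unfolding \<G>_def by auto
      with dom show ?thesis by blast
    next
      case False
      with covered that(1) show ?thesis by blast
    qed
    ultimately have "insert M \<D> \<in> \<A>" unfolding \<A>_def by blast
    with maximal have "M \<in> \<D>" by blast
    with M show False unfolding \<G>_def by blast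
  qed
  then have "\<Union>\<C> \<subseteq> (\<Union>D\<in>\<D>. \<Delta> D)"
    using covered unfolding \<G>_def by blast
  with \<D> show ?thesis by blast
qed

text \<open>If the supremum \<open>s\<close> is positive, then \<open>s / \<kappa>\<close> lies
  strictly below it and is exceeded by some value of \<open>f\<close>. This argument fails for
  \<open>s = 0\<close>, but then \<open>f\<close> vanishes on \<open>A\<close> and any point will
  do.\<close>

lemma near_maximum:
  fixes f :: "'b \<Rightarrow> real"
  assumes "A \<noteq> {}" "bdd_above (f ` A)" "\<kappa> > 1" "\<And>a. a \<in> A \<Longrightarrow> f a \<ge> 0"
  shows "\<exists>m\<in>A. \<forall>a\<in>A. f a \<le> \<kappa> * f m"
proof (cases "\<exists>a\<in>A. f a > 0")
  case True
  define s where "s = (SUP a\<in>A. f a)"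
  have le_s: "f a \<le> s" if "a \<in> A" for a
    unfolding s_def using assms(2) that by (rule cSUP_upper2) simp
  with True have "s > 0" by force
  with assms(3) have "s / \<kappa> < s" by (simp add: field_simps)
  then obtain m where "m \<in> A" "s / \<kappa> < f m"
    using less_cSUP_iff[OF assms(1,2)] unfolding s_def by blast
  then have "s \<le> \<kappa> * f m"
    using assms(3) by (simp add: field_simps)
  with le_s \<open>m \<in> A\<close> show ?thesis by (meson order_trans)
next
  case False
  with assms(4) have "f a = 0" if "a \<in> A" for a
    using that by (simp add: dual_order.antisym not_less)
  with assms(1) show ?thesis by auto
qed

theorem lemma1:
  fixes X :: "'a set" and \<C> :: "'a set set" and \<Delta> :: "'a set \<Rightarrow> 'a set"
  assumes "X \<noteq> {}"
    and "\<C> \<subseteq> Pow X" and "\<C> \<noteq> {}"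
    and "\<Delta> \<in> \<C> \<rightarrow> Pow X"
    and "\<And>C. C \<in> \<C> \<Longrightarrow> C \<subseteq> \<Delta> C"
    and "V1 \<C> \<Delta> \<or> V2 \<C> \<Delta>"
  shows "\<exists>\<D>. \<D> \<subseteq> \<C> \<and> pairwise disjnt \<D> \<and> (\<Union>C\<in>\<C>. C) \<subseteq> (\<Union>D\<in>\<D>. \<Delta> D)"
proof -
  \<comment> \<open>Under \<open>V1\<close> a near-maximum of \<gamma> on \<G> with factor \<kappa>
    serves as \<open>M\<close>; under \<open>V2\<close> a true maximum does. In both cases every
    \<open>C\<close> in \<G> satisfies the inequality required for the inclusion.\<close>
  have "\<exists>M\<in>\<G>. \<forall>C\<in>\<G>. C \<inter> M \<noteq> {} \<longrightarrow> C \<subseteq> \<Delta> M" if \<G>: "\<G> \<subseteq> \<C>" "\<G> \<noteq> {}" for \<G>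
    using assms(6)
  proof
    assume "V1 \<C> \<Delta>"
    then obtain \<gamma> :: "'a set \<Rightarrow> real" and \<kappa> :: real
      where \<gamma>: "\<gamma> \<in> \<C> \<rightarrow> {0..}" "bounded (\<gamma> ` \<C>)" "\<kappa> > 1"
        and incl: "\<forall>C\<in>\<C>. \<forall>M\<in>\<C>. C \<inter> M \<noteq> {} \<and> \<gamma> C \<le> \<kappa> * \<gamma> M \<longrightarrow> C \<subseteq> \<Delta> M"
      unfolding V1_def by blast
    have "bdd_above (\<gamma> ` \<G>)"
      using \<gamma>(2) \<G>(1) by (meson bounded_imp_bdd_above bounded_subset image_mono)
    moreover have "\<gamma> C \<ge> 0" if "C \<in> \<G>" for C
      using \<gamma>(1) \<G>(1) that by auto
    ultimately obtain M where "M \<in> \<G>" "\<forall>C\<in>\<G>. \<gamma> C \<le> \<kappa> * \<gamma> M"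
      using near_maximum[of \<G> \<gamma> \<kappa>] \<G>(2) \<gamma>(3) by blast
    with incl \<G>(1) show ?thesis by blast
  next
    assume "V2 \<C> \<Delta>"
    then obtain \<gamma> :: "'a set \<Rightarrow> real"
      where max: "\<forall>\<G>. \<G> \<subseteq> \<C> \<and> \<G> \<noteq> {} \<longrightarrow> has_maximum (\<gamma> ` \<G>)"
        and incl: "\<forall>C\<in>\<C>. \<forall>M\<in>\<C>. C \<inter> M \<noteq> {} \<and> \<gamma> C \<le> \<gamma> M \<longrightarrow> C \<subseteq> \<Delta> M"
      unfolding V2_def by (elim exE conjE) (rule that)
    from max \<G> have "has_maximum (\<gamma> ` \<G>)" by blast
    then obtain M where "M \<in> \<G>" "\<forall>C\<in>\<G>. \<gamma> C \<le> \<gamma> M"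
      unfolding has_maximum_def by blast
    with incl \<G>(1) show ?thesis by blast
  qed
  from exists_disjoint_cover[OF this] show ?thesis by simp
qed

end
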